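(* Let $m$ and $n$ be positive integers, $q=2^m$, $\gamma\in\mathbb{F}_{q^n}$ and $c_1,c_2\in\mathbb{F}_q$. Let $f(X)=X+\gamma\,\mathrm{Tr}_{q}^{q^n}\left(c_1X+c_2X^2+X^2\,\mathrm{Tr}_{q}^{q^n}(X)\right)\in\mathbb{F}_{q^n}[X]$. Then $f(X)$ is a permutation polynomial over $\mathbb{F}_{q^n}$ if and only if one of the following conditions holds: (i) $\mathrm{Tr}_{q}^{q^n}(\gamma)=0$; (ii) $\mathrm{Tr}_{q}^{q^n}(\gamma)(c_1+c_2^2)=1$ and $m$ is odd.
   Context: For a prime power $q$, $\mathbb{F}_q$ is the finite field with $q$ elements. $\mathrm{Tr}_{q}^{q^n}(x)=x+x^q+\cdots+x^{q^{n-1}}$ is the relative trace from $\mathbb{F}_{q^n}$ to $\mathbb{F}_q$. A polynomial $f\in\mathbb{F}_{Q}[X]$ is a permutation polynomial over $\mathbb{F}_{Q}$ if the map $c\mapsto f(c)$ is a bijection of $\mathbb{F}_{Q}$ to itself. *)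

theory Defs
  imports "HOL-Computational_Algebra.Polynomial" "HOL-Library.Cardinality"
begin

definition is_subfield :: "'a::field set \<Rightarrow> bool" where
  "is_subfield K \<longleftrightarrow> 0 \<in> K \<and> 1 \<in> K \<and>
     (\<forall>x\<in>K. \<forall>y\<in>K. x + y \<in> K \<and> x * y \<in> K) \<and>
     (\<forall>x\<in>K. - x \<in> K \<and> inverse x \<in> K)"

text \<open>
  The trace expression $x + x^q + \dots + x^{q^{n-1}}$ is formed in an arbitrary commutative
  ring, so that it applies both to elements of the field with $q^n$ elements and to
  polynomials over it.
\<close>

definition rel_trace :: "nat \<Rightarrow> nat \<Rightarrow> 'a::comm_ring_1 \<Rightarrow> 'a" where
  "rel_trace q n x = (\<Sum>i<n. x ^ (q ^ i))"

definition permutation_poly :: "'a::{field,finite} poly \<Rightarrow> bool" where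
  "permutation_poly f \<longleftrightarrow> bij (\<lambda>c. poly f c)"

end

theory Submission
  imports Defs
begin

text \<open>
  On $\mathbb{F}_{q^n}$ one has $f(x) = x + \gamma h(\mathrm{Tr}\,x)$ with
  $h(t) = c_1 t + c_2 t^2 + t^3$, so $\mathrm{Tr} \circ f = g \circ \mathrm{Tr}$ for
  $g(t) = t + \mathrm{Tr}(\gamma) h(t)$. As the trace is onto $\mathbb{F}_q$, $f$ is a permutation of
  $\mathbb{F}_{q^n}$ iff $g$ is one of $\mathbb{F}_q$. If $\mathrm{Tr}(\gamma) = 0$ then $g$ is the
  identity. Otherwise $g(s + c_2) / \mathrm{Tr}(\gamma)$ equals $s^3 + a s$ up to a constant, with
  $a = c_1 + c_2^2 + 1 / \mathrm{Tr}(\gamma)$. If $a \neq 0$ this vanishes at $0$ and at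
  $\sqrt{a} \neq 0$; if $a = 0$ it is the cube map, which is injective on $\mathbb{F}_{2^m}$
  iff $m$ is odd.
\<close>

section \<open>Power identities in finite fields and root counting\<close>

lemma finite_field_power_card_minus_one:
  fixes K :: "'a::field set"
  assumes "is_subfield K" and "finite K" and "x \<in> K" and "x \<noteq> 0"
  shows "x ^ (card K - 1) = 1"
proof -
  let ?U = "K - {0}"
  have "0 \<in> K" and mult: "\<And>x y. x \<in> K \<Longrightarrow> y \<in> K \<Longrightarrow> x * y \<in> K"
    and inv: "\<And>x. x \<in> K \<Longrightarrow> inverse x \<in> K"
    using assms(1) by (auto simp: is_subfield_def)
  \<comment> \<open>Multiplication by \<open>x\<close> permutes the nonzero elements, so their
    product, itself nonzero, absorbs a factor \<open>x ^ card ?U\<close>.\<close>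
  have "bij_betw (\<lambda>y. x * y) ?U ?U"
    by (rule bij_betw_byWitness[where f' = "\<lambda>y. inverse x * y"])
       (use assms mult inv in \<open>auto simp: mult.assoc[symmetric]\<close>)
  then have "(\<Prod>y\<in>?U. y) = (\<Prod>y\<in>?U. x * y)"
    by (rule prod.reindex_bij_betw[symmetric])
  also have "\<dots> = x ^ card ?U * (\<Prod>y\<in>?U. y)"
    by (simp add: prod.distrib)
  finally have "x ^ card ?U = 1"
    using assms(2) by simp
  then show ?thesis
    using \<open>0 \<in> K\<close> assms(2) by simp
qed

lemma finite_field_power_card:
  fixes K :: "'a::field set"
  assumes "is_subfield K" and "finite K" and "x \<in> K"
  shows "x ^ card K = x"
proof -
  have "card K > 0"
    using assms by (auto simp: card_gt_0_iff)
  then show ?thesis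
    using finite_field_power_card_minus_one[OF assms] power_minus_mult[of "card K" x]
    by (cases "x = 0") auto
qed

lemma is_subfield_UNIV: "is_subfield UNIV"
  by (simp add: is_subfield_def)

text \<open>Translation by 1 permutes the field, so adding 1 to every element leaves the sum of all
  elements unchanged.\<close>

lemma of_nat_CARD_eq_0: "of_nat CARD('a) = (0 :: 'a::{field,finite})"
proof -
  have "(\<Sum>x\<in>(UNIV :: 'a set). x) = (\<Sum>x\<in>UNIV. x + 1)"
    by (rule sum.reindex_bij_betw[symmetric]) (rule bij_betw_byWitness[where f' = "\<lambda>x. x - 1"], auto)
  then show ?thesis
    by (simp add: sum.distrib)
qed

lemma is_subfield_power:
  assumes "is_subfield K" and "x \<in> K"
  shows "x ^ k \<in> K"
  using assms by (induction k) (auto simp: is_subfield_def)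

lemma power_two_power_add:
  fixes x y :: "'a::comm_ring_1"
  assumes "(2 :: 'a) = 0"
  shows "(x + y) ^ (2 ^ k) = x ^ (2 ^ k) + y ^ (2 ^ k)"
proof (induction k)
  case (Suc k)
  have "(x + y) ^ (2 ^ Suc k) = ((x + y) ^ (2 ^ k)) ^ 2"
    by (simp add: power_mult[symmetric] mult.commute)
  also have "\<dots> = (x ^ (2 ^ k)) ^ 2 + (y ^ (2 ^ k)) ^ 2"
    using assms by (simp add: Suc power2_sum)
  finally show ?case
    by (simp add: power_mult[symmetric] mult.commute)
qed simp

lemma card_poly_zeros_le:
  fixes p :: "'a::idom poly"
  assumes "degree p \<le> k" and "p \<noteq> 0" and "\<And>x. x \<in> A \<Longrightarrow> poly p x = 0"
  shows "card A \<le> k"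
proof -
  have "A \<subseteq> {x. poly p x = 0}"
    using assms by auto
  then have "card A \<le> card {x. poly p x = 0}"
    using poly_roots_finite[OF assms(2)] by (rule card_mono[rotated])
  then show ?thesis
    using card_poly_roots_bound[OF assms(2)] assms(1) by linarith
qed

lemma poly_rel_trace: "poly (rel_trace q n p) x = rel_trace q n (poly p x)"
  by (simp add: rel_trace_def poly_sum)

section \<open>Injectivity of cubic polynomials on a field of order 2^m\<close>

lemma subfield_has_cube_root_of_unity:
  fixes K :: "'a::field set"
  assumes "is_subfield K" and "finite K" and "card K > 1" and "3 dvd card K - 1"
  obtains w where "w \<in> K" and "w ^ 3 = 1" and "w \<noteq> 1"
proof -
  obtain k where k: "card K - 1 = 3 * k"
    using assms(4) by blast
  then have "k > 0"
    using assms(3) by (intro gr0I) simp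
  let ?p = "monom 1 k - 1 :: 'a poly"
  \<comment> \<open>Otherwise \<open>?p\<close>, of degree at most \<open>k\<close>, would have all
    \<open>3 * k\<close> nonzero elements of \<open>K\<close> as roots. Any exception
    \<open>x\<close> supplies the root of unity \<open>x ^ k\<close>.\<close>
  have "\<not> (\<forall>x\<in>K - {0}. x ^ k = 1)"
  proof
    assume "\<forall>x\<in>K - {0}. x ^ k = 1"
    moreover have "degree ?p \<le> k"
      by (intro degree_diff_le) (simp_all add: degree_monom_le)
    moreover have "coeff ?p k = 1"
      using \<open>k > 0\<close> by simp
    then have "?p \<noteq> 0"
      by (metis coeff_0 zero_neq_one)
    ultimately have "card (K - {0}) \<le> k"
      by (intro card_poly_zeros_le[of ?p]) (auto simp: poly_monom)
    moreover have "card (K - {0}) = 3 * k"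
      using assms k by (simp add: is_subfield_def)
    ultimately show False
      using \<open>k > 0\<close> by simp
  qed
  then obtain x where x: "x \<in> K" "x \<noteq> 0" "x ^ k \<noteq> 1"
    by blast
  show ?thesis
  proof
    show "x ^ k \<in> K"
      using assms x by (simp add: is_subfield_power)
    show "(x ^ k) ^ 3 = 1"
      using finite_field_power_card_minus_one[OF assms(1,2) x(1,2)]
      unfolding k by (simp add: power_mult[symmetric] mult.commute)
    show "x ^ k \<noteq> 1"
      by fact
  qed
qed

text \<open>For even \<open>m\<close>, 3 divides \<open>card K - 1\<close>, and a nontrivial cube
  root of unity has the same cube as 1. For odd \<open>m\<close>, cubing is inverted by an explicit
  power map.\<close>

lemma inj_on_cube_iff:
  fixes K :: "'a::field set"
  assumes "is_subfield K" and "card K = 2 ^ m" and "m > 0"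
  shows "inj_on (\<lambda>x. x ^ 3) K \<longleftrightarrow> odd m"
proof
  have fin: "finite K"
    using assms(2) by (intro card_ge_0_finite) simp
  have "card K > 1"
    using one_less_power[of "2 :: nat" m] assms by simp
  have mod3: "(4 :: nat) ^ j mod 3 = 1" for j
    using power_mod[of "4 :: nat" 3 j] by simp
  {
    assume "inj_on (\<lambda>x. x ^ 3) K"
    show "odd m"
    proof
      assume "even m"
      then obtain j where j: "m = 2 * j"
        by blast
      have "card K = 4 ^ j"
        by (simp add: assms j power_mult)
      then have "3 dvd card K - 1"
        using mod3[of j] by presburger
      then obtain w where "w \<in> K" "w ^ 3 = 1" "w \<noteq> 1"
        using subfield_has_cube_root_of_unity[OF assms(1) fin \<open>card K > 1\<close>] by blast
      then show False
        using inj_onD[OF \<open>inj_on (\<lambda>x. x ^ 3) K\<close>, of w 1] assms(1)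
        by (simp add: is_subfield_def)
    qed
  next
    assume "odd m"
    then obtain j where j: "m = 2 * j + 1"
      by (elim oddE)
    \<comment> \<open>Doubling makes the exponent of 2 even, and powers of 4 are 1 modulo 3. So
      \<open>2 * card K - 1\<close>, an exponent fixing every element of \<open>K\<close>, is a
      multiple of 3.\<close>
    have "2 * card K = 4 ^ (j + 1)"
      by (simp add: assms j power_mult)
    then have "3 dvd 2 * card K - 1"
      using mod3[of "j + 1"] by presburger
    then obtain k where k: "2 * card K - 1 = 3 * k"
      by blast
    have "(x ^ 3) ^ k = x" if "x \<in> K" for x
    proof -
      have "2 * card K - 1 = card K + (card K - 1)"
        using \<open>card K > 1\<close> by simp
      then have "(x ^ 3) ^ k = x * x ^ (card K - 1)"
        using finite_field_power_card[OF assms(1) fin that]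
        by (metis k power_add power_mult)
      then show ?thesis
        using finite_field_power_card_minus_one[OF assms(1) fin that] by (cases "x = 0") auto
    qed
    then show "inj_on (\<lambda>x. x ^ 3) K"
      by (rule inj_on_inverseI)
  }
qed

lemma inj_on_depressed_cubic_iff:
  fixes K :: "'a::field set"
  assumes "is_subfield K" and "card K = 2 ^ m" and "m > 0" and "(2 :: 'a) = 0" and "a \<in> K"
  shows "inj_on (\<lambda>s. s ^ 3 + a * s) K \<longleftrightarrow> a = 0 \<and> odd m"
proof (cases "a = 0")
  case True
  then show ?thesis
    using inj_on_cube_iff[OF assms(1-3)] by simp
next
  case False
  have fin: "finite K"
    using assms(2) by (intro card_ge_0_finite) simp
  \<comment> \<open>This is the square root of \<open>a\<close>: squaring it gives
    \<open>a ^ card K\<close>, which is \<open>a\<close>.\<close>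
  define b where "b = a ^ (2 ^ (m - 1))"
  have "b ^ 2 = a ^ (2 ^ Suc (m - 1))"
    by (simp add: b_def power_mult[symmetric] mult.commute)
  also have "\<dots> = a"
    using finite_field_power_card[OF assms(1) fin assms(5)] assms(2,3) by simp
  finally have b: "b ^ 2 = a" .
  have "b ^ 3 + a * b = 2 * b ^ 3"
    by (simp add: b[symmetric] power2_eq_square power3_eq_cube)
  then have "b ^ 3 + a * b = 0"
    using assms(4) by simp
  moreover have "b \<noteq> 0"
    using b False by auto
  moreover have "b \<in> K" "0 \<in> K"
    using assms by (auto simp: b_def is_subfield_power is_subfield_def)
  ultimately have "\<not> inj_on (\<lambda>s. s ^ 3 + a * s) K"
    using inj_onD[of "\<lambda>s. s ^ 3 + a * s" K b 0] by auto
  then show ?thesis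
    using False by simp
qed

lemma inj_on_cubic_iff:
  fixes K :: "'a::field set"
  assumes K: "is_subfield K" and "card K = 2 ^ m" and "m > 0" and two: "(2 :: 'a) = 0"
    and "c1 \<in> K" and "c2 \<in> K" and "d \<in> K"
  shows "inj_on (\<lambda>t. t + d * (c1 * t + c2 * t ^ 2 + t ^ 3)) K
    \<longleftrightarrow> d = 0 \<or> (d * (c1 + c2 ^ 2) = 1 \<and> odd m)"
proof (cases "d = 0")
  case True
  then show ?thesis
    by simp
next
  case False
  define g where "g = (\<lambda>t. t + d * (c1 * t + c2 * t ^ 2 + t ^ 3))"
  define a where "a = c1 + c2 ^ 2 + inverse d"
  have neg: "- x = x" for x :: 'a
    using two by (metis mult_2 mult_zero_left neg_eq_iff_add_eq_0)
  have add: "\<And>x y. x \<in> K \<Longrightarrow> y \<in> K \<Longrightarrow> x + y \<in> K"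
    using K by (simp add: is_subfield_def)
  have "a \<in> K"
    using assms by (auto simp: a_def is_subfield_def power2_eq_square)
  \<comment> \<open>In characteristic two the shift is its own inverse.\<close>
  have bij: "bij_betw (\<lambda>s. s + c2) K K"
    by (rule bij_betw_byWitness[where f' = "\<lambda>s. s + c2"])
       (use add assms neg in \<open>auto simp: add.assoc eq_neg_iff_add_eq_0[symmetric]\<close>)
  have g: "g (s + c2) = d * (s ^ 3 + a * s) + g c2" for s
  proof -
    \<comment> \<open>The shift by \<open>c2\<close> leaves the quadratic term with coefficient
      \<open>4 * d * c2\<close>. The last summand collects this and the surplus linear terms, all
      even multiples; the linear term \<open>s\<close> itself becomes
      \<open>d * inverse d * s\<close>.\<close>
    have "g (s + c2) = d * (s ^ 3 + a * s) + g c2 + 2 * (d * (2 * c2 * s ^ 2 + c2 ^ 2 * s + c2 ^ 2 * s))"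
      using False by (simp add: g_def a_def field_simps power2_eq_square power3_eq_cube)
    then show ?thesis
      using two by simp
  qed
  have "inj_on g K \<longleftrightarrow> inj_on (g \<circ> (\<lambda>s. s + c2)) K"
    using comp_inj_on_iff[of "\<lambda>s. s + c2" K g] bij by (simp add: bij_betw_def)
  \<comment> \<open>Neither the nonzero factor \<open>d\<close> nor the constant \<open>g c2\<close>
    affects injectivity.\<close>
  also have "\<dots> \<longleftrightarrow> inj_on (\<lambda>s. s ^ 3 + a * s) K"
    using False by (simp add: inj_on_def g)
  also have "\<dots> \<longleftrightarrow> a = 0 \<and> odd m"
    using inj_on_depressed_cubic_iff[OF assms(1-4) \<open>a \<in> K\<close>] .
  also have "a = 0 \<longleftrightarrow> c1 + c2 ^ 2 = inverse d"
    unfolding a_def using neg by (metis eq_neg_iff_add_eq_0)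
  also have "\<dots> \<longleftrightarrow> d * (c1 + c2 ^ 2) = 1"
    using False by (auto simp: field_simps)
  finally show ?thesis
    using False by (simp add: g_def)
qed

section \<open>The relative trace in characteristic two\<close>

locale finite_field_trace_char_two =
  fixes m n q :: nat and K :: "'a::{field,finite} set"
  assumes m: "m > 0" and n: "n > 0" and q: "q = 2 ^ m" and CARD: "CARD('a) = q ^ n"
    and K: "is_subfield K" and card_K: "card K = q"
begin

text \<open>The order of the field vanishes in it and is a power of two; a field has no nonzero
  nilpotent elements.\<close>

lemma two_eq_0: "(2 :: 'a) = 0"
  using of_nat_CARD_eq_0[where 'a = 'a] by (simp add: CARD q)

lemma q_gt_1: "q > 1"
  using one_less_power[of "2 :: nat" m] m q by simp

lemma q_power: "q ^ i = 2 ^ (m * i)"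
  by (simp add: q power_mult)

text \<open>The \<open>q\<close> elements of \<open>K\<close> are already as many roots as X^q - X
  can have. Membership in \<open>K\<close> thus becomes an equation that can be checked for
  traces.\<close>

lemma mem_K_iff: "x \<in> K \<longleftrightarrow> x ^ q = x"
proof -
  let ?p = "monom 1 q - monom 1 1 :: 'a poly"
  have "degree ?p \<le> q"
    using q_gt_1 by (intro degree_diff_le order.trans[OF degree_monom_le]) auto
  moreover have "coeff ?p q = 1"
    using q_gt_1 by simp
  then have "?p \<noteq> 0"
    by (metis coeff_0 zero_neq_one)
  ultimately have "card {x :: 'a. x ^ q = x} \<le> q"
    by (rule card_poly_zeros_le) (simp add: poly_monom)
  moreover have "K \<subseteq> {x. x ^ q = x}"
    using finite_field_power_card[OF K] by (auto simp: card_K)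
  ultimately have "K = {x. x ^ q = x}"
    by (intro card_seteq) (auto simp: card_K)
  then show ?thesis
    by blast
qed

lemma power_q_power: "x \<in> K \<Longrightarrow> x ^ (q ^ i) = x"
  by (induction i) (simp_all add: power_mult mem_K_iff)

lemma rel_trace_add: "rel_trace q n (x + y) = rel_trace q n x + rel_trace q n (y :: 'a)"
  by (simp add: rel_trace_def q_power power_two_power_add[OF two_eq_0] sum.distrib)

lemma rel_trace_scale: "c \<in> K \<Longrightarrow> rel_trace q n (c * x) = c * rel_trace q n x"
  by (simp add: rel_trace_def power_mult_distrib power_q_power sum_distrib_left)

lemma sum_power_two_power: "(\<Sum>i\<in>A. h i :: 'a) ^ (2 ^ k) = (\<Sum>i\<in>A. h i ^ (2 ^ k))"
  by (induction A rule: infinite_finite_induct) (simp_all add: power_two_power_add[OF two_eq_0])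

text \<open>Squaring is additive in characteristic two and commutes with all powers.\<close>

lemma rel_trace_square: "rel_trace q n (x ^ 2) = rel_trace q n (x :: 'a) ^ 2"
  using sum_power_two_power[of "\<lambda>i. x ^ (q ^ i)" "{..<n}" 1]
  by (simp add: rel_trace_def power_mult[symmetric] mult.commute)

lemma rel_trace_mem: "rel_trace q n (x :: 'a) \<in> K"
proof -
  \<comment> \<open>The q-th power shifts the summands by one index; the new last one,
    \<open>x ^ (q ^ n)\<close>, equals the lost first one, \<open>x\<close>.\<close>
  have "rel_trace q n x ^ q = (\<Sum>i<n. x ^ (q ^ Suc i))"
    using sum_power_two_power[of "\<lambda>i. x ^ (q ^ i)" "{..<n}" m]
    by (simp add: rel_trace_def power_mult[symmetric] mult.commute q)
  also have "\<dots> = (\<Sum>i<Suc n. x ^ (q ^ i)) - x"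
    by (subst sum.lessThan_Suc_shift) simp
  also have "x ^ (q ^ n) = x"
    using finite_field_power_card[OF is_subfield_UNIV, of x] by (simp add: CARD)
  then have "(\<Sum>i<Suc n. x ^ (q ^ i)) - x = rel_trace q n x"
    by (simp add: rel_trace_def)
  finally show ?thesis
    by (simp add: mem_K_iff)
qed

text \<open>As a polynomial, the trace is nonzero of degree at most \<open>q ^ (n - 1)\<close>, so
  it cannot vanish at all \<open>q ^ n\<close> elements.\<close>

lemma rel_trace_nonzero: "\<exists>x :: 'a. rel_trace q n x \<noteq> 0"
proof (rule ccontr)
  assume *: "\<not> ?thesis"
  let ?p = "\<Sum>i<n. monom 1 (q ^ i) :: 'a poly"
  have "degree ?p \<le> q ^ (n - 1)"
    using q_gt_1 by (intro degree_sum_le order.trans[OF degree_monom_le]) (auto intro!: power_increasing)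
  moreover have "coeff ?p (q ^ (n - 1)) = 1"
    using q_gt_1 n by (simp add: coeff_sum if_distrib sum.delta cong: if_cong)
  then have "?p \<noteq> 0"
    by (metis coeff_0 zero_neq_one)
  ultimately have "CARD('a) \<le> q ^ (n - 1)"
    by (rule card_poly_zeros_le) (use * in \<open>auto simp: poly_sum poly_monom rel_trace_def\<close>)
  moreover have "q ^ (n - 1) < q ^ n"
    using q_gt_1 n by (intro power_strict_increasing) auto
  ultimately show False
    by (simp add: CARD)
qed

text \<open>By linearity over \<open>K\<close>, an element of nonzero trace can be rescaled to any
  prescribed trace.\<close>

lemma rel_trace_surj:
  assumes "k \<in> K"
  obtains x :: 'a where "rel_trace q n x = k"
proof -
  obtain y :: 'a where y: "rel_trace q n y \<noteq> 0"
    using rel_trace_nonzero by blast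
  have "k * inverse (rel_trace q n y) \<in> K"
    using K assms rel_trace_mem[of y] by (simp add: is_subfield_def)
  then have "rel_trace q n (k * inverse (rel_trace q n y) * y) = k"
    using y by (simp add: rel_trace_scale)
  then show ?thesis
    by (rule that)
qed

text \<open>The trace carries the map on the large field to the map on \<open>K\<close>.
  Surjectivity descends along the trace, and on the finite set \<open>K\<close> it gives
  injectivity. Conversely, equal values force equal traces, after which the terms in \<gamma>
  cancel.\<close>

lemma bij_add_trace_iff:
  fixes h :: "'a \<Rightarrow> 'a"
  assumes h: "\<And>t. t \<in> K \<Longrightarrow> h t \<in> K"
  shows "bij (\<lambda>x. x + \<gamma> * h (rel_trace q n x))
    \<longleftrightarrow> inj_on (\<lambda>t. t + rel_trace q n \<gamma> * h t) K"
proof -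
  let ?f = "\<lambda>x. x + \<gamma> * h (rel_trace q n x)" and ?g = "\<lambda>t. t + rel_trace q n \<gamma> * h t"
  have Tf: "rel_trace q n (?f x) = ?g (rel_trace q n x)" for x
    using rel_trace_scale[OF h[OF rel_trace_mem[of x]], of \<gamma>]
    by (simp add: rel_trace_add mult.commute)
  show ?thesis
  proof
    assume "bij ?f"
    have "K \<subseteq> ?g ` K"
    proof
      fix k assume "k \<in> K"
      then obtain z where z: "rel_trace q n z = k"
        by (rule rel_trace_surj)
      obtain x where "z = ?f x"
        using bij_is_surj[OF \<open>bij ?f\<close>] by (rule surjE)
      then have "k = ?g (rel_trace q n x)"
        using z Tf by simp
      then show "k \<in> ?g ` K"
        using rel_trace_mem by blast
    qed
    then have "card K \<le> card (?g ` K)"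
      by (intro card_mono) auto
    then show "inj_on ?g K"
      using card_image_le[of K ?g] by (intro eq_card_imp_inj_on) auto
  next
    assume inj: "inj_on ?g K"
    have "inj ?f"
    proof (rule injI)
      fix x y assume eq: "?f x = ?f y"
      then have "?g (rel_trace q n x) = ?g (rel_trace q n y)"
        by (metis Tf)
      then have "rel_trace q n x = rel_trace q n y"
        using inj rel_trace_mem by (blast dest: inj_onD)
      then show "x = y"
        using eq by simp
    qed
    then show "bij ?f"
      by (simp add: bij_def finite_UNIV_inj_surj)
  qed
qed

end

theorem theorem4p3:
  fixes m n q :: nat
    and K :: "'a::{field,finite} set"
    and \<gamma> c1 c2 :: 'a
    and X f :: "'a poly"
  assumes "m > 0" and "n > 0" and "q = 2 ^ m"
    and "CARD('a) = q ^ n"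
    and "is_subfield K" and "card K = q"
    and "c1 \<in> K" and "c2 \<in> K"
    and "X = [:0, 1:]"
    and "f = X + smult \<gamma> (rel_trace q n (smult c1 X + smult c2 (X ^ 2) + X ^ 2 * rel_trace q n X))"
  shows "permutation_poly f \<longleftrightarrow>
    rel_trace q n \<gamma> = 0 \<or> (rel_trace q n \<gamma> * (c1 + c2 ^ 2) = 1 \<and> odd m)"
proof -
  interpret finite_field_trace_char_two m n q K
    by unfold_locales fact+
  let ?h = "\<lambda>t. c1 * t + c2 * t ^ 2 + t ^ 3"
  have "poly f x = x + \<gamma> * ?h (rel_trace q n x)" for x
  proof -
    \<comment> \<open>The inner trace lies in \<open>K\<close> and comes out as a scalar; the trace
      of the square supplies the other two factors.\<close>
    have "rel_trace q n (x ^ 2 * rel_trace q n x) = rel_trace q n x ^ 3"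
      using rel_trace_scale[OF rel_trace_mem, of x "x ^ 2"]
      unfolding rel_trace_square by (simp add: mult.commute power3_eq_cube power2_eq_square)
    then show ?thesis
      using assms(7-10) rel_trace_scale[OF assms(7), of x]
      by (simp add: mult.commute poly_rel_trace rel_trace_add rel_trace_scale rel_trace_square)
  qed
  then have "permutation_poly f \<longleftrightarrow> bij (\<lambda>x. x + \<gamma> * ?h (rel_trace q n x))"
    by (simp add: permutation_poly_def)
  also have "\<dots> \<longleftrightarrow> inj_on (\<lambda>t. t + rel_trace q n \<gamma> * ?h t) K"
    by (rule bij_add_trace_iff)
       (use K assms(7,8) in \<open>auto simp: is_subfield_def power2_eq_square power3_eq_cube\<close>)
  also have "\<dots> \<longleftrightarrow> rel_trace q n \<gamma> = 0 \<or> (rel_trace q n \<gamma> * (c1 + c2 ^ 2) = 1 \<and> odd m)"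
    using inj_on_cubic_iff[OF K _ m two_eq_0 assms(7,8) rel_trace_mem] card_K q by simp
  finally show ?thesis .
qed

end
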